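(* Consider the two-stage implicit Runge-Kutta method in which every coefficient except $b_2$ is that of the two-stage, fourth-order Gauss method: $c_1=\frac12-\frac{\sqrt3}{6}$, $c_2=\frac12+\frac{\sqrt3}{6}$, $a_{11}=a_{22}=\frac14$, $a_{12}=\frac14-\frac{\sqrt3}{6}$, $a_{21}=\frac14+\frac{\sqrt3}{6}$, $b_1=\frac12$. Solving the zero phase-lag equation $\phi(\upsilon)=0$ for $b_2$ gives $$b_2=\frac12\cdot\frac{N(\upsilon)}{M(\upsilon)},$$ where $$N(\upsilon)=-6\upsilon^3+6\sqrt3\,\upsilon^3+72\upsilon-\upsilon^4\tan\upsilon+24\upsilon^2\tan\upsilon+\sqrt3\,\upsilon^4\tan\upsilon-12\sqrt3\,\upsilon^2\tan\upsilon-144\tan\upsilon,$$ $$M(\upsilon)=\sqrt3\,\upsilon^4\tan\upsilon+6\upsilon^3+6\sqrt3\,\upsilon^3-36\upsilon^2\tan\upsilon-12\sqrt3\,\upsilon^2\tan\upsilon-72\upsilon,$$ so that the method with this $b_2$ has zero phase-lag (zero dispersion). The Taylor series expansion of $b_2$ is $$b_2=\frac12+\frac{1}{720}\upsilon^4+\left(\frac{1}{6720}-\frac{\sqrt3}{8640}\right)\upsilon^6+\ldots,$$ and $\lim_{\upsilon\to0}b_2=\frac12$, i.e. the corresponding coefficient of the Gauss method is recovered as the step length tends to zero.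
   Context: An $s$-stage implicit Runge-Kutta method with coefficients $a_{ij}$, $b_j$, $c_i$ ($1\le i,j\le s$) and step $h$ for $y'=f(t,y)$ is $w_i=f\bigl(t_n+c_ih,\;y_n+h\sum_{j=1}^s a_{ij}w_j\bigr)$, $y_{n+1}=y_n+h\sum_{i=1}^s b_iw_i$, where at least one $a_{ij}$ with $i\le j$ is nonzero. Applied to the linear equation $y'=qy$ ($q\in\mathbb C$) it gives $y_{n+1}=P(z)y_n$ with $z=hq$ and $$P(z)=\frac{\det(I-zB)}{\det(I-zA)},\qquad A=(a_{ij})_{1\le i,j\le s},\quad B=(a_{ij}-b_j)_{1\le i,j\le s}.$$ The phase-lag (dispersion error) is $\phi(\upsilon)=\upsilon-\arg(P(i\upsilon))$ for $\upsilon\in\mathbb R$, where $i=\sqrt{-1}$. When a coefficient depends on $\upsilon$, $P(i\upsilon)$ is computed with the coefficients evaluated at that same $\upsilon$. Zero phase-lag means $\phi(\upsilon)=0$.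
   Formalization: Zero phase-lag is stated for υ in (−π, π] with tan υ defined, arg being the principal argument, since φ(υ)=0 is impossible for other real υ; for all real υ with tan υ defined and M(υ)≠0, the formula for b_2 is shown equivalent to φ(υ) being a multiple of π. *)

theory Defs
  imports "HOL-Analysis.Analysis"
begin

record 's butcher_tableau =
  coeff_a :: "real ^ 's ^ 's"
  coeff_b :: "real ^ 's"
  coeff_c :: "real ^ 's"

text \<open>One step of length \<open>h\<close> from \<open>(t, y)\<close> to \<open>y'\<close>. It is a relation, since the stage
  equations are implicit in the stages \<open>w\<close>.\<close>

definition rk_step ::
  "('s::finite) butcher_tableau \<Rightarrow> (real \<Rightarrow> 'a::real_vector \<Rightarrow> 'a) \<Rightarrow> real \<Rightarrow> real \<Rightarrow> 'a \<Rightarrow> 'a \<Rightarrow> bool"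
where
  "rk_step R f h t y y' \<longleftrightarrow>
     (\<exists>w. (\<forall>i. w i = f (t + coeff_c R $ i * h)
                       (y + h *\<^sub>R (\<Sum>j\<in>UNIV. coeff_a R $ i $ j *\<^sub>R w j))) \<and>
          y' = y + h *\<^sub>R (\<Sum>i\<in>UNIV. coeff_b R $ i *\<^sub>R w i))"

definition stability_function :: "('s::finite) butcher_tableau \<Rightarrow> complex \<Rightarrow> complex" where
  "stability_function R z =
     det (mat 1 - (\<chi> i j. z * of_real (coeff_a R $ i $ j - coeff_b R $ j)) :: complex ^ 's ^ 's) /
     det (mat 1 - (\<chi> i j. z * of_real (coeff_a R $ i $ j)) :: complex ^ 's ^ 's)"

text \<open>The coefficients may depend on \<open>\<upsilon>\<close>, so the phase-lag is that of a family \<open>R\<close> of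
  methods. \<open>Arg\<close> is the principal argument, with values in \<open>{-pi<..pi}\<close>; hence the
  phase-lag can vanish only for \<open>\<upsilon>\<close> in that interval.\<close>

definition phase_lag :: "(real \<Rightarrow> ('s::finite) butcher_tableau) \<Rightarrow> real \<Rightarrow> real" where
  "phase_lag R \<upsilon> = \<upsilon> - Arg (stability_function (R \<upsilon>) (\<i> * of_real \<upsilon>))"

text \<open>\<open>vector\<close> lists a matrix by rows. In the index type \<open>2\<close> the literal \<open>2\<close> equals \<open>0\<close>, but
  \<open>$ 1\<close> and \<open>$ 2\<close> still select the first and second entries of \<open>vector [x, y]\<close>.\<close>

definition gauss2 :: "2 butcher_tableau" where
  "gauss2 =
    \<lparr> coeff_a = vector [vector [1/4, 1/4 - sqrt 3 / 6],
                         vector [1/4 + sqrt 3 / 6, 1/4]],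
      coeff_b = vector [1/2, 1/2],
      coeff_c = vector [1/2 - sqrt 3 / 6, 1/2 + sqrt 3 / 6] \<rparr>"

definition gauss2_with_b2 :: "real \<Rightarrow> 2 butcher_tableau" where
  "gauss2_with_b2 \<beta> = gauss2 \<lparr> coeff_b := (\<chi> i. if i = 2 then \<beta> else coeff_b gauss2 $ i) \<rparr>"

definition N_fun :: "real \<Rightarrow> real" where
  "N_fun \<upsilon> =
     - 6 * \<upsilon>^3 + 6 * sqrt 3 * \<upsilon>^3 + 72 * \<upsilon> - \<upsilon>^4 * tan \<upsilon> + 24 * \<upsilon>^2 * tan \<upsilon>
     + sqrt 3 * \<upsilon>^4 * tan \<upsilon> - 12 * sqrt 3 * \<upsilon>^2 * tan \<upsilon> - 144 * tan \<upsilon>"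

definition M_fun :: "real \<Rightarrow> real" where
  "M_fun \<upsilon> =
     sqrt 3 * \<upsilon>^4 * tan \<upsilon> + 6 * \<upsilon>^3 + 6 * sqrt 3 * \<upsilon>^3 - 36 * \<upsilon>^2 * tan \<upsilon>
     - 12 * sqrt 3 * \<upsilon>^2 * tan \<upsilon> - 72 * \<upsilon>"

text \<open>Mathematically meaningful only where \<open>cos \<upsilon> \<noteq> 0\<close> and \<open>M_fun \<upsilon> \<noteq> 0\<close>; in particular not
  at \<open>\<upsilon> = 0\<close>, where it is \<open>0 / 0\<close>.\<close>

definition b2_opt :: "real \<Rightarrow> real" where
  "b2_opt \<upsilon> = 1/2 * (N_fun \<upsilon> / M_fun \<upsilon>)"

lemma two_stage_linear_solve:
  fixes y q h a11 a12 a21 a22 b1 b2 w1 w2 y' :: complex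
  assumes w1: "w1 = q * (y + h * (a11 * w1 + a12 * w2))"
    and w2: "w2 = q * (y + h * (a21 * w1 + a22 * w2))"
    and y': "y' = y + h * (b1 * w1 + b2 * w2)"
  shows "((1 - h*q*a11) * (1 - h*q*a22) - h*q*a12 * (h*q*a21)) * y' =
         ((1 - h*q*(a11 - b1)) * (1 - h*q*(a22 - b2)) - h*q*(a12 - b2) * (h*q*(a21 - b1))) * y"
    (is "?D * y' = ?E * y")
proof -
  define e1 where "e1 = w1 - q * (y + h * (a11 * w1 + a12 * w2))"
  define e2 where "e2 = w2 - q * (y + h * (a21 * w1 + a22 * w2))"
  have e: "e1 = 0" "e2 = 0"
    using w1 w2 by (simp_all add: e1_def e2_def)
  have "?D * w1 = q * y * (1 - h*q*a22 + h*q*a12) + (1 - h*q*a22) * e1 + h*q*a12 * e2"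
    unfolding e1_def e2_def by (simp add: algebra_simps)
  then have D1: "?D * w1 = q * y * (1 - h*q*a22 + h*q*a12)"
    by (simp add: e)
  have "?D * w2 = q * y * (1 - h*q*a11 + h*q*a21) + (1 - h*q*a11) * e2 + h*q*a21 * e1"
    unfolding e1_def e2_def by (simp add: algebra_simps)
  then have D2: "?D * w2 = q * y * (1 - h*q*a11 + h*q*a21)"
    by (simp add: e)
  have "?D * y' = ?D * y + h * b1 * (?D * w1) + h * b2 * (?D * w2)"
    unfolding y' by (simp add: algebra_simps)
  also have "\<dots> = ?E * y"
    unfolding D1 D2 by (simp add: algebra_simps)
  finally show ?thesis .
qed

text \<open>On the linear test equation a two-stage step is multiplication by the stability
  function.\<close>

lemma rk_step_linear_two_stage:
  fixes R :: "2 butcher_tableau" and q y y' :: complex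
  assumes nz: "det (mat 1 - (\<chi> i j. of_real h * q * of_real (coeff_a R $ i $ j)) :: complex ^ 2 ^ 2) \<noteq> 0"
    and step: "rk_step R (\<lambda>_ u. q * u) h t y y'"
  shows "y' = stability_function R (of_real h * q) * y"
proof -
  from step obtain w :: "2 \<Rightarrow> complex" where
    w: "\<And>i. w i = q * (y + h *\<^sub>R (\<Sum>j\<in>UNIV. coeff_a R $ i $ j *\<^sub>R w j))" and
    y': "y' = y + h *\<^sub>R (\<Sum>i\<in>UNIV. coeff_b R $ i *\<^sub>R w i)"
    unfolding rk_step_def by blast
  note w1 = w[of 1, unfolded sum_2 scaleR_conv_of_real]
    and w2 = w[of 2, unfolded sum_2 scaleR_conv_of_real]
    and y'2 = y'[unfolded sum_2 scaleR_conv_of_real]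
  let ?D = "(1 - of_real h * q * of_real (coeff_a R $ 1 $ 1)) * (1 - of_real h * q * of_real (coeff_a R $ 2 $ 2))
     - of_real h * q * of_real (coeff_a R $ 1 $ 2) * (of_real h * q * of_real (coeff_a R $ 2 $ 1)) :: complex"
  let ?E = "(1 - of_real h * q * (of_real (coeff_a R $ 1 $ 1) - of_real (coeff_b R $ 1))) *
       (1 - of_real h * q * (of_real (coeff_a R $ 2 $ 2) - of_real (coeff_b R $ 2)))
     - of_real h * q * (of_real (coeff_a R $ 1 $ 2) - of_real (coeff_b R $ 2)) *
       (of_real h * q * (of_real (coeff_a R $ 2 $ 1) - of_real (coeff_b R $ 1))) :: complex"
  have "?D * y' = ?E * y"
    by (rule two_stage_linear_solve[OF w1 w2 y'2])
  moreover have "?D \<noteq> 0"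
    using nz by (simp add: det_2 mat_def)
  ultimately show ?thesis
    by (simp add: stability_function_def det_2 mat_def field_simps)
qed

end

theory Submission
  imports Defs
begin

text \<open>
  Write \<open>E\<close> and \<open>D\<close> for the numerator and denominator of the stability function \<open>P\<close> at
  \<open>\<i>\<upsilon>\<close>, and \<open>W = E * cnj D * cis (- \<upsilon>)\<close>. Since \<open>W\<close> is \<open>P * cis (- \<upsilon>)\<close> times the positive
  number \<open>\<bar>D\<bar>\<^sup>2\<close>, the argument of \<open>W\<close> is minus the phase-lag up to multiples of \<open>2 * pi\<close>. The
  free coefficient \<open>b\<close> enters the determinant \<open>E\<close> only to first order, because it occupies
  one column of \<open>B\<close> and is subtracted there from both entries. Hence
  \<open>Im W = phase_offset \<upsilon> + b * phase_slope \<upsilon>\<close>. As \<open>W\<close> never vanishes, the phase-lag is a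
  multiple of \<open>pi\<close> exactly when this affine expression is zero (\<open>sin_phase_lag_eq_0_iff\<close>).
  Dividing by \<open>cos \<upsilon>\<close> turns its coefficients into \<open>N_fun\<close> and \<open>M_fun\<close>, up to constant
  factors, so that the root is \<open>b2_opt \<upsilon>\<close>.

  For \<open>\<upsilon>\<close> in \<open>{-pi<..pi}\<close> the multiple of \<open>pi\<close> has to be identified as zero, which amounts to
  \<open>Re W > 0\<close>. Once \<open>W\<close> is real, \<open>phase_slope \<upsilon> * Re W\<close> is the imaginary part of
  \<open>cnj W * (\<partial>W / \<partial>b)\<close>, in which both the rotation and the value of \<open>b\<close> cancel; what is left has the
  sign of \<open>\<upsilon>\<close> (\<open>slope_times_Re_rotated\<close>). So it is enough that \<open>phase_slope\<close> also has the sign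
  of \<open>\<upsilon>\<close> on that interval (\<open>phase_slope_pos\<close>), and this shows at the same time that
  \<open>M_fun \<upsilon>\<close> is nonzero.

  Near \<open>0\<close>, \<open>b2_opt\<close> is the quotient of two odd power series with nonzero linear terms.
  The singularity is therefore removable, and the Taylor coefficients follow one by one by
  comparing coefficients in \<open>F * fps_phase_slope = - fps_phase_offset\<close>.
\<close>

section \<open>The stability function of the modified method\<close>

definition gauss_num :: "real \<Rightarrow> complex \<Rightarrow> complex" where
  "gauss_num \<beta> z = 1 + of_real \<beta> * z + of_real ((1 - sqrt 3 + 2 * sqrt 3 * \<beta>) / 12) * z\<^sup>2"

definition gauss_den :: "complex \<Rightarrow> complex" where
  "gauss_den z = 1 - z / 2 + z\<^sup>2 / 12"

lemma stability_function_gauss2_with_b2: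
  "stability_function (gauss2_with_b2 \<beta>) z = gauss_num \<beta> z / gauss_den z"
proof -
  have "(of_real (sqrt 3))\<^sup>2 = (3 :: complex)"
    by (metis of_real_numeral of_real_power real_sqrt_pow2 zero_le_numeral)
  then have s: "of_real (sqrt 3) * (of_real (sqrt 3) * x) = 3 * x"
    "of_real (sqrt 3) * of_real (sqrt 3) = (3 :: complex)" for x :: complex
    by (simp_all add: power2_eq_square flip: mult.assoc)
  have "det (mat 1 - (\<chi> i j. z * of_real (coeff_a (gauss2_with_b2 \<beta>) $ i $ j
          - coeff_b (gauss2_with_b2 \<beta>) $ j)) :: complex ^ 2 ^ 2) = gauss_num \<beta> z"
    by (simp add: det_2 mat_def gauss2_def gauss2_with_b2_def gauss_num_def
        algebra_simps add_divide_distrib diff_divide_distrib power2_eq_square s)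
  moreover have "det (mat 1 - (\<chi> i j. z * of_real (coeff_a (gauss2_with_b2 \<beta>) $ i $ j))
          :: complex ^ 2 ^ 2) = gauss_den z"
    by (simp add: det_2 mat_def gauss2_def gauss2_with_b2_def gauss_den_def
        algebra_simps add_divide_distrib diff_divide_distrib power2_eq_square s)
  ultimately show ?thesis
    by (simp add: stability_function_def)
qed

lemma Re_gauss_num: "Re (gauss_num \<beta> (\<i> * of_real \<upsilon>)) = 1 - (1 - sqrt 3 + 2 * sqrt 3 * \<beta>) / 12 * \<upsilon>\<^sup>2"
  and Im_gauss_num: "Im (gauss_num \<beta> (\<i> * of_real \<upsilon>)) = \<beta> * \<upsilon>"
  and Re_gauss_den: "Re (gauss_den (\<i> * of_real \<upsilon>)) = 1 - \<upsilon>\<^sup>2 / 12"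
  and Im_gauss_den: "Im (gauss_den (\<i> * of_real \<upsilon>)) = - \<upsilon> / 2"
  by (simp_all add: gauss_num_def gauss_den_def power2_eq_square)

lemmas gauss_ReIm = Re_gauss_num Im_gauss_num Re_gauss_den Im_gauss_den

lemma gauss_den_nonzero: "gauss_den (\<i> * of_real \<upsilon>) \<noteq> 0"
proof (cases "\<upsilon> = 0")
  case True
  then show ?thesis by (simp add: gauss_den_def)
next
  case False
  then show ?thesis by (simp add: complex_eq_iff gauss_ReIm)
qed

text \<open>The numerator can vanish at \<open>\<i>\<upsilon>\<close> only for \<open>\<beta> * \<upsilon> = 0\<close>, and then its real part is at least
  \<open>1\<close> because \<open>1 - sqrt 3 < 0\<close>. Nonvanishing matters since \<open>Arg 0 = 0\<close> carries no information
  about a phase.\<close>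

lemma gauss_num_nonzero: "gauss_num \<beta> (\<i> * of_real \<upsilon>) \<noteq> 0"
proof (cases "\<beta> * \<upsilon> = 0")
  case True
  have "1 - (1 - sqrt 3) / 12 * \<upsilon>\<^sup>2 > 0"
  proof -
    have "(1 - sqrt 3) * \<upsilon>\<^sup>2 \<le> 0"
      by (intro mult_nonpos_nonneg) auto
    then show ?thesis by simp
  qed
  with True show ?thesis
    by (auto simp: complex_eq_iff gauss_ReIm)
next
  case False
  then show ?thesis by (simp add: complex_eq_iff gauss_ReIm)
qed

section \<open>The phase-lag equation is affine in the free coefficient\<close>

text \<open>The imaginary part of \<open>E * cnj D * cis (- \<upsilon>)\<close> as a polynomial of degree one in the free
  coefficient: \<open>phase_offset\<close> is its constant term and \<open>phase_slope\<close> its leading coefficient.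
  They are expanded into products of a power with \<open>sin\<close> or \<open>cos\<close> so that their power series
  can be read off term by term.\<close>

definition phase_offset :: "real \<Rightarrow> real" where
  "phase_offset \<upsilon> = 1/2 * (\<upsilon> * cos \<upsilon>) - (1 - sqrt 3) / 24 * (\<upsilon>^3 * cos \<upsilon>)
     - sin \<upsilon> + (2 - sqrt 3) / 12 * (\<upsilon>^2 * sin \<upsilon>) - (1 - sqrt 3) / 144 * (\<upsilon>^4 * sin \<upsilon>)"

definition phase_slope :: "real \<Rightarrow> real" where
  "phase_slope \<upsilon> = \<upsilon> * cos \<upsilon> - (1 + sqrt 3) / 12 * (\<upsilon>^3 * cos \<upsilon>)
     + (1 / 2 + sqrt 3 / 6) * (\<upsilon>^2 * sin \<upsilon>) - sqrt 3 / 72 * (\<upsilon>^4 * sin \<upsilon>)"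

lemma Im_rotated:
  "Im (gauss_num \<beta> (\<i> * of_real \<upsilon>) * cnj (gauss_den (\<i> * of_real \<upsilon>)) * cis (- \<upsilon>))
     = phase_offset \<upsilon> + \<beta> * phase_slope \<upsilon>"
  by (simp add: gauss_ReIm phase_offset_def phase_slope_def field_simps power2_eq_square
      power3_eq_cube power4_eq_xxxx)

text \<open>Let \<open>W1\<close> be the derivative of \<open>W\<close> with respect to \<open>\<beta>\<close>, so that \<open>Im W1\<close> is the slope. For
  real \<open>W\<close> the product of slope and \<open>Re W\<close> is \<open>Im (cnj W * W1)\<close>. The common factor
  \<open>cnj D * cis (- \<upsilon>)\<close> contributes only its squared modulus, and the part of \<open>W\<close> proportional to
  \<open>\<beta>\<close> contributes nothing, as it is a real multiple of \<open>W1\<close>. This removes \<open>\<beta>\<close> and all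
  trigonometric functions from the right-hand side.\<close>

lemma slope_times_Re_rotated:
  fixes \<beta> \<upsilon> :: real
  defines "D \<equiv> gauss_den (\<i> * of_real \<upsilon>)"
  defines "W \<equiv> gauss_num \<beta> (\<i> * of_real \<upsilon>) * cnj D * cis (- \<upsilon>)"
  assumes "Im W = 0"
  shows "phase_slope \<upsilon> * Re W = (cmod D)\<^sup>2 * (\<upsilon> * (1 + (sqrt 3 - 1) / 12 * \<upsilon>\<^sup>2))"
proof -
  define E where "E = gauss_num \<beta> (\<i> * of_real \<upsilon>)"
  \<comment> \<open>the coefficient of \<open>\<beta>\<close> in \<open>E\<close>\<close>
  define E1 where "E1 = Complex (- (sqrt 3 / 6) * \<upsilon>\<^sup>2) \<upsilon>"
  define W1 where "W1 = E1 * cnj D * cis (- \<upsilon>)"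
  have "Im W1 = phase_slope \<upsilon>"
    by (simp add: W1_def E1_def D_def gauss_ReIm phase_slope_def field_simps power2_eq_square
        power3_eq_cube power4_eq_xxxx)
  then have "phase_slope \<upsilon> * Re W = Im (cnj W * W1)"
    using assms(3) by simp
  also have "cnj W * W1 = (cnj E * E1) * (D * cnj D) * (cis \<upsilon> * cis (- \<upsilon>))"
    by (simp add: W_def W1_def E_def cis_cnj)
  also have "\<dots> = of_real ((cmod D)\<^sup>2) * (cnj E * E1)"
    by (simp add: cis_mult flip: complex_norm_square)
  also have "Im \<dots> = (cmod D)\<^sup>2 * Im (cnj E * E1)"
    by (simp only: Im_complex_of_real Re_complex_of_real times_complex.simps)
  also have "Im (cnj E * E1) = \<upsilon> * (1 + (sqrt 3 - 1) / 12 * \<upsilon>\<^sup>2)"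
    by (simp add: E_def E1_def gauss_ReIm field_simps power2_eq_square)
  finally show ?thesis .
qed

lemma times_cis_minus_polar:
  "z * cis (- \<upsilon>) = of_real (cmod z) * cnj (cis (\<upsilon> - Arg z))"
proof -
  have "z * cis (- \<upsilon>) = rcis (cmod z) (Arg z) * cis (- \<upsilon>)"
    by (simp add: rcis_cmod_Arg)
  then show ?thesis
    by (simp add: rcis_def cis_mult cis_cnj mult.assoc)
qed

text \<open>The link between the argument and the rotated product. The factor is
  \<open>c = \<bar>D\<bar>\<^sup>2 * \<bar>P\<bar> = \<bar>E\<bar> * \<bar>D\<bar>\<close>; its positivity lets signs of \<open>Re W\<close> decide the branch of the
  argument.\<close>

lemma phase_lag_sin_cos:
  fixes \<beta> :: "real \<Rightarrow> real" and \<upsilon> :: real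
  defines "D \<equiv> gauss_den (\<i> * of_real \<upsilon>)"
  defines "W \<equiv> gauss_num (\<beta> \<upsilon>) (\<i> * of_real \<upsilon>) * cnj D * cis (- \<upsilon>)"
  defines "\<phi> \<equiv> phase_lag (\<lambda>u. gauss2_with_b2 (\<beta> u)) \<upsilon>"
  obtains c where "c > 0" "Re W = c * cos \<phi>" "Im W = - c * sin \<phi>"
proof -
  define P where "P = gauss_num (\<beta> \<upsilon>) (\<i> * of_real \<upsilon>) / D"
  have D: "D \<noteq> 0" by (simp add: D_def gauss_den_nonzero)
  have P: "P \<noteq> 0" using D by (simp add: P_def gauss_num_nonzero)
  have \<phi>: "\<phi> = \<upsilon> - Arg P"
    by (simp add: \<phi>_def phase_lag_def stability_function_gauss2_with_b2 P_def D_def)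
  have "W = P * (D * cnj D) * cis (- \<upsilon>)"
    using D by (simp add: W_def P_def)
  also have "\<dots> = of_real ((cmod D)\<^sup>2) * (P * cis (- \<upsilon>))"
    by (simp flip: complex_norm_square)
  also have "\<dots> = of_real ((cmod D)\<^sup>2 * cmod P) * cnj (cis \<phi>)"
    by (simp add: times_cis_minus_polar \<phi>)
  finally have "W = of_real ((cmod D)\<^sup>2 * cmod P) * cnj (cis \<phi>)" .
  then have "Re W = (cmod D)\<^sup>2 * cmod P * cos \<phi>" "Im W = - ((cmod D)\<^sup>2 * cmod P) * sin \<phi>"
    by (simp_all only:) simp_all
  then show ?thesis
    using that[of "(cmod D)\<^sup>2 * cmod P"] D P by simp
qed

lemma sin_phase_lag_eq_0_iff:
  "sin (phase_lag (\<lambda>u. gauss2_with_b2 (\<beta> u)) \<upsilon>) = 0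
     \<longleftrightarrow> phase_offset \<upsilon> + \<beta> \<upsilon> * phase_slope \<upsilon> = 0"
proof -
  obtain c where "c > 0" "phase_offset \<upsilon> + \<beta> \<upsilon> * phase_slope \<upsilon>
      = - c * sin (phase_lag (\<lambda>u. gauss2_with_b2 (\<beta> u)) \<upsilon>)"
    using phase_lag_sin_cos[of \<beta> \<upsilon>] unfolding Im_rotated by metis
  then show ?thesis by simp
qed

lemma M_fun_eq: "cos \<upsilon> \<noteq> 0 \<Longrightarrow> M_fun \<upsilon> = - 72 * phase_slope \<upsilon> / cos \<upsilon>"
  by (simp add: M_fun_def phase_slope_def tan_def field_simps power2_eq_square)

lemma N_fun_eq: "cos \<upsilon> \<noteq> 0 \<Longrightarrow> N_fun \<upsilon> = 144 * phase_offset \<upsilon> / cos \<upsilon>"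
  by (simp add: N_fun_def phase_offset_def tan_def field_simps power2_eq_square
      power3_eq_cube power4_eq_xxxx)

lemma b2_opt_eq: "cos \<upsilon> \<noteq> 0 \<Longrightarrow> b2_opt \<upsilon> = - phase_offset \<upsilon> / phase_slope \<upsilon>"
  by (simp add: b2_opt_def M_fun_eq N_fun_eq)

lemma affine_root_iff:
  assumes "cos \<upsilon> \<noteq> 0" "M_fun \<upsilon> \<noteq> 0"
  shows "phase_offset \<upsilon> + b * phase_slope \<upsilon> = 0 \<longleftrightarrow> b = 1/2 * (N_fun \<upsilon> / M_fun \<upsilon>)"
proof -
  have "phase_slope \<upsilon> \<noteq> 0"
    using assms by (auto simp: M_fun_eq)
  then show ?thesis
    unfolding b2_opt_def[symmetric] using assms(1) by (auto simp: b2_opt_eq field_simps)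
qed

section \<open>The branch of the argument\<close>

lemma phase_slope_minus: "phase_slope (- \<upsilon>) = - phase_slope \<upsilon>"
  by (simp add: phase_slope_def)

text \<open>Up to the factor \<open>\<upsilon>\<close>, the slope is \<open>cos \<upsilon> * p + sin \<upsilon> * q\<close> with \<open>q > \<upsilon> / 2\<close>, while \<open>p\<close>
  decreases from \<open>1\<close> and changes sign at some point near \<open>2.1\<close>, after \<open>cos\<close> does at \<open>pi / 2\<close>. Both
  summands are therefore nonnegative except between these two points. There
  \<open>sin \<upsilon> \<ge> - cos \<upsilon>\<close>, which holds up to \<open>3 * pi / 4 > 2.1\<close>, and \<open>p < q\<close> give the claim.\<close>

lemma phase_slope_pos:
  assumes "0 < \<upsilon>" "\<upsilon> \<le> pi"
  shows "phase_slope \<upsilon> > 0"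
proof -
  define s where "s = sqrt 3"
  have s: "1.73 < s" "s < 1.74"
    unfolding s_def by (rule real_less_rsqrt real_less_lsqrt; simp add: power2_eq_square)+
  define p where "p = 1 - (1 + s) / 12 * \<upsilon>\<^sup>2"
  define q where "q = \<upsilon> * (1 / 2 + s / 6 - s / 72 * \<upsilon>\<^sup>2)"
  have slope: "phase_slope \<upsilon> = \<upsilon> * (cos \<upsilon> * p + sin \<upsilon> * q)"
    by (simp add: phase_slope_def p_def q_def s_def field_simps power2_eq_square
        power3_eq_cube power4_eq_xxxx)
  have pi: "3.14 < pi" "pi < 3.15"
    using pi_approx by auto
  have "\<upsilon>\<^sup>2 \<le> 3.15\<^sup>2"
    using assms pi by (intro power_mono) auto
  then have v2: "\<upsilon>\<^sup>2 < 10" by (simp add: power2_eq_square)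
  have "s * \<upsilon>\<^sup>2 \<le> 1.74 * 10"
    using s v2 by (intro mult_mono) auto
  then have qf: "1 / 2 + s / 6 - s / 72 * \<upsilon>\<^sup>2 > 0.5"
    using s v2 by simp
  then have q: "q > 0.5 * \<upsilon>"
    using assms(1) unfolding q_def by (simp add: mult.commute)
  have "cos \<upsilon> * p + sin \<upsilon> * q > 0"
  proof -
    consider "\<upsilon> \<le> pi / 2" | "pi / 2 < \<upsilon>" "\<upsilon> \<le> 3 * pi / 4" | "3 * pi / 4 < \<upsilon>" by linarith
    then show ?thesis
    proof cases
      case 1
      then have "\<upsilon>\<^sup>2 \<le> 1.575\<^sup>2"
        using assms pi by (intro power_mono) auto
      then have "(1 + s) * \<upsilon>\<^sup>2 \<le> 2.74 * 2.5"
        using s by (intro mult_mono) (auto simp: power2_eq_square)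
      then have "p > 0" by (simp add: p_def)
      moreover have "cos \<upsilon> \<ge> 0" "sin \<upsilon> > 0"
        using 1 assms by (auto intro: cos_ge_zero sin_gt_zero)
      ultimately show ?thesis using q assms(1)
        by (intro add_nonneg_pos mult_nonneg_nonneg mult_pos_pos) auto
    next
      case 2
      then have "sin \<upsilon> > 0"
        using assms pi by (intro sin_gt_zero) auto
      have "cos \<upsilon> < 0"
        using cos_gt_zero[of "pi - \<upsilon>"] 2 by simp
      have "- cos \<upsilon> = sin (\<upsilon> - pi / 2)"
        by (simp add: sin_diff)
      also have "\<dots> \<le> sin (pi - \<upsilon>)"
        using 2 by (intro sin_monotone_2pi_le) auto
      finally have sc: "- cos \<upsilon> \<le> sin \<upsilon>" by simp
      show ?thesis
      proof (cases "p \<le> 0")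
        case True
        then show ?thesis using \<open>sin \<upsilon> > 0\<close> \<open>cos \<upsilon> < 0\<close> q assms(1)
          by (intro add_nonneg_pos mult_nonpos_nonpos mult_pos_pos) auto
      next
        case False
        have "1.57\<^sup>2 \<le> \<upsilon>\<^sup>2"
          using 2 pi by (intro power_mono) auto
        then have "2.73 * 2.4 \<le> (1 + s) * \<upsilon>\<^sup>2"
          using s by (intro mult_mono) (auto simp: power2_eq_square)
        then have "p < q" using q 2 pi by (simp add: p_def)
        have "- cos \<upsilon> * p \<le> sin \<upsilon> * p"
          using sc False by (intro mult_right_mono) auto
        also have "\<dots> < sin \<upsilon> * q"
          using \<open>p < q\<close> \<open>sin \<upsilon> > 0\<close> by simp
        finally show ?thesis by simp
      qed
    next
      case 3
      have "2.35\<^sup>2 \<le> \<upsilon>\<^sup>2"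
        using 3 pi by (intro power_mono) auto
      then have "2.73 * 5.5 \<le> (1 + s) * \<upsilon>\<^sup>2"
        using s by (intro mult_mono) (auto simp: power2_eq_square)
      then have "p < 0" by (simp add: p_def)
      moreover have "cos \<upsilon> < 0"
        using cos_gt_zero_pi[of "pi - \<upsilon>"] 3 assms by simp
      moreover have "sin \<upsilon> \<ge> 0"
        using assms by (intro sin_ge_zero) auto
      ultimately show ?thesis using q assms(1)
        by (intro add_pos_nonneg mult_neg_neg mult_nonneg_nonneg) auto
    qed
  qed
  then show ?thesis using assms(1) slope by simp
qed

lemma phase_slope_sgn:
  assumes "\<upsilon> \<in> {-pi<..pi}" "\<upsilon> \<noteq> 0"
  shows "\<upsilon> * phase_slope \<upsilon> > 0"
proof (cases "\<upsilon> > 0")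
  case True
  with assms show ?thesis by (simp add: phase_slope_pos)
next
  case False
  with assms have "phase_slope (- \<upsilon>) > 0"
    by (intro phase_slope_pos) auto
  with False assms show ?thesis by (simp add: phase_slope_minus mult_neg_neg)
qed

text \<open>A root of the affine equation makes the phase-lag a multiple of \<open>pi\<close>. On the range of the
  principal argument it lies strictly between \<open>-2 * pi\<close> and \<open>2 * pi\<close>, and \<open>Re W > 0\<close> makes its
  cosine positive, which excludes \<open>pi\<close> and \<open>- pi\<close>.\<close>

lemma phase_lag_eq_0_iff:
  assumes "\<upsilon> \<in> {-pi<..pi}" "\<upsilon> \<noteq> 0"
  shows "phase_lag (\<lambda>u. gauss2_with_b2 (\<beta> u)) \<upsilon> = 0
     \<longleftrightarrow> phase_offset \<upsilon> + \<beta> \<upsilon> * phase_slope \<upsilon> = 0"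
    (is "?\<phi> = 0 \<longleftrightarrow> ?eq")
proof
  assume "?\<phi> = 0"
  then show ?eq using sin_phase_lag_eq_0_iff[of \<beta> \<upsilon>] by simp
next
  assume eq: ?eq
  define D where "D = gauss_den (\<i> * of_real \<upsilon>)"
  define W where "W = gauss_num (\<beta> \<upsilon>) (\<i> * of_real \<upsilon>) * cnj D * cis (- \<upsilon>)"
  obtain c where c: "c > 0" "Re W = c * cos ?\<phi>"
    using phase_lag_sin_cos[of \<beta> \<upsilon>] unfolding W_def D_def by metis
  have "Im W = 0"
    using eq by (simp only: W_def D_def Im_rotated)
  then have "\<upsilon> * phase_slope \<upsilon> * Re W = (cmod D)\<^sup>2 * \<upsilon>\<^sup>2 * (1 + (sqrt 3 - 1) / 12 * \<upsilon>\<^sup>2)"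
    using slope_times_Re_rotated[of "\<beta> \<upsilon>" \<upsilon>] by (simp add: W_def D_def power2_eq_square)
  moreover have "1 + (sqrt 3 - 1) / 12 * \<upsilon>\<^sup>2 > 0"
    by (intro add_pos_nonneg) auto
  moreover have "D \<noteq> 0"
    by (simp add: D_def gauss_den_nonzero)
  ultimately have "\<upsilon> * phase_slope \<upsilon> * Re W > 0"
    using assms(2) by simp
  then have "Re W > 0"
    using phase_slope_sgn[OF assms] by (simp add: zero_less_mult_iff)
  then have cos: "cos ?\<phi> > 0"
    using c by (simp add: zero_less_mult_iff)
  have "sin ?\<phi> = 0"
    using eq sin_phase_lag_eq_0_iff[of \<beta> \<upsilon>] by simp
  then obtain k :: int where k: "?\<phi> = of_int k * pi"
    using sin_zero_iff_int2 by blast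
  have "\<bar>?\<phi>\<bar> < 2 * pi"
    using assms(1) Arg_bounded unfolding phase_lag_def abs_less_iff
    by (smt (verit) greaterThanAtMost_iff)
  then have "\<bar>of_int k\<bar> * pi < 2 * pi"
    by (simp add: k abs_mult)
  then have "\<bar>k\<bar> < 2" by simp
  then have "k = 0 \<or> k = 1 \<or> k = - 1" by linarith
  then show "?\<phi> = 0"
    using cos k by auto
qed

lemma M_fun_nonzero:
  assumes "\<upsilon> \<in> {-pi<..pi}" "\<upsilon> \<noteq> 0" "cos \<upsilon> \<noteq> 0"
  shows "M_fun \<upsilon> \<noteq> 0"
  using phase_slope_sgn[OF assms(1,2)] assms(3) by (auto simp: M_fun_eq)

lemma phase_lag_at_0: "phase_lag R 0 = 0"
proof -
  have "stability_function (R 0) 0 = 1"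
    by (simp add: stability_function_def flip: zero_vec_def)
  then show ?thesis
    by (simp add: phase_lag_def)
qed

section \<open>Taylor expansion\<close>

definition fps_phase_offset :: "real fps" where
  "fps_phase_offset = fps_const (1/2) * (fps_X * fps_cos 1)
     - fps_const ((1 - sqrt 3) / 24) * (fps_X ^ 3 * fps_cos 1) - fps_sin 1
     + fps_const ((2 - sqrt 3) / 12) * (fps_X ^ 2 * fps_sin 1)
     - fps_const ((1 - sqrt 3) / 144) * (fps_X ^ 4 * fps_sin 1)"

definition fps_phase_slope :: "real fps" where
  "fps_phase_slope = fps_X * fps_cos 1
     - fps_const ((1 + sqrt 3) / 12) * (fps_X ^ 3 * fps_cos 1)
     + fps_const (1 / 2 + sqrt 3 / 6) * (fps_X ^ 2 * fps_sin 1)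
     - fps_const (sqrt 3 / 72) * (fps_X ^ 4 * fps_sin 1)"

lemma has_fps_expansion_phase_offset: "phase_offset has_fps_expansion fps_phase_offset"
  unfolding phase_offset_def[abs_def] fps_phase_offset_def
  by (intro fps_expansion_intros)

lemma has_fps_expansion_phase_slope: "phase_slope has_fps_expansion fps_phase_slope"
  unfolding phase_slope_def[abs_def] fps_phase_slope_def
  by (intro fps_expansion_intros)

lemma fps_phase_slope_nth:
  "fps_nth fps_phase_slope 0 = 0"
  "fps_nth fps_phase_slope 1 = 1"
  "fps_nth fps_phase_slope 2 = 0"
  "fps_nth fps_phase_slope 3 = (sqrt 3 - 1) / 12"
  "fps_nth fps_phase_slope 4 = 0"
  "fps_nth fps_phase_slope 5 = 0"
  "fps_nth fps_phase_slope 6 = 0"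
  "fps_nth fps_phase_slope 7 = sqrt 3 / 4320 - 1/1440"
  by (simp_all add: fps_phase_slope_def fps_X_power_mult_nth fps_sin_def fps_cos_def fact_numeral
      field_simps)

lemma fps_phase_offset_nth:
  "fps_nth fps_phase_offset 0 = 0"
  "fps_nth fps_phase_offset 1 = - 1/2"
  "fps_nth fps_phase_offset 2 = 0"
  "fps_nth fps_phase_offset 3 = (1 - sqrt 3) / 24"
  "fps_nth fps_phase_offset 4 = 0"
  "fps_nth fps_phase_offset 5 = - 1/720"
  "fps_nth fps_phase_offset 6 = 0"
  "fps_nth fps_phase_offset 7 = 19/60480 - sqrt 3 / 8640"
  by (simp_all add: fps_phase_offset_def fps_X_power_mult_nth fps_sin_def fps_cos_def fact_numeral
      field_simps)

text \<open>Both series start with a linear term, so the quotient is a power series with constant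
  term \<open>1/2\<close>. It represents \<open>b2_opt\<close> only where \<open>cos \<upsilon> \<noteq> 0\<close>, which is enough near \<open>0\<close>. The
  second conclusion, free of division, is the form that determines the coefficients.\<close>

lemma b2_opt_expansion:
  obtains F where "(\<lambda>\<upsilon>. if \<upsilon> = 0 then 1/2 else b2_opt \<upsilon>) has_fps_expansion F"
    "F * fps_phase_slope = - fps_phase_offset"
proof
  define F where "F = - fps_phase_offset / fps_phase_slope"
  have nz: "fps_phase_slope \<noteq> 0"
    using fps_phase_slope_nth(2) by force
  have sd: "subdegree fps_phase_slope = 1"
    using fps_phase_slope_nth by (intro subdegreeI) auto
  have "fps_phase_offset \<noteq> 0"
    using fps_phase_offset_nth(2) by force
  then have sd': "subdegree fps_phase_slope \<le> subdegree (- fps_phase_offset)"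
    unfolding sd using fps_phase_offset_nth by (intro subdegree_geI) auto
  then show "F * fps_phase_slope = - fps_phase_offset"
    unfolding F_def using \<open>fps_phase_offset \<noteq> 0\<close> nz by (simp add: fps_dvd_iff)
  have "(\<lambda>\<upsilon>. if \<upsilon> = 0 then 1/2 else - phase_offset \<upsilon> / phase_slope \<upsilon>) has_fps_expansion F"
    unfolding F_def
    by (rule has_fps_expansion_divide)
      (use sd sd' nz has_fps_expansion_phase_offset has_fps_expansion_phase_slope in
        \<open>auto simp: sd fps_phase_slope_nth(2)[simplified] fps_phase_offset_nth(2)[simplified] intro: has_fps_expansion_minus\<close>)
  moreover have "eventually (\<lambda>\<upsilon>. \<upsilon> \<in> {- (pi / 2)<..<pi / 2}) (nhds 0)"
    by (rule eventually_nhds_in_open) auto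
  then have "eventually (\<lambda>\<upsilon>. (if \<upsilon> = 0 then 1/2 else - phase_offset \<upsilon> / phase_slope \<upsilon>)
      = (if \<upsilon> = 0 then 1/2 else b2_opt \<upsilon>)) (nhds 0)"
  proof eventually_elim
    case (elim \<upsilon>)
    then have "cos \<upsilon> > 0" by (simp add: cos_gt_zero_pi)
    then show ?case by (simp add: b2_opt_eq)
  qed
  ultimately show "(\<lambda>\<upsilon>. if \<upsilon> = 0 then 1/2 else b2_opt \<upsilon>) has_fps_expansion F"
    unfolding has_fps_expansion_def by (auto elim: eventually_elim2)
qed

text \<open>The linear coefficient of \<open>fps_phase_slope\<close> is \<open>1\<close> and its constant term is \<open>0\<close>, so
  comparing the coefficients of index \<open>n + 1\<close> gives the coefficient of index \<open>n\<close> from the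
  earlier ones.\<close>

lemma b2_opt_taylor_coefficients:
  assumes F: "F * fps_phase_slope = - fps_phase_offset"
  shows "fps_nth F 0 = 1/2" "fps_nth F 1 = 0" "fps_nth F 2 = 0" "fps_nth F 3 = 0"
    "fps_nth F 4 = 1/720" "fps_nth F 5 = 0" "fps_nth F 6 = 1/6720 - sqrt 3 / 8640"
proof -
  have conv: "(\<Sum>i\<le>n. fps_nth F i * fps_nth fps_phase_slope (n - i)) = - fps_nth fps_phase_offset n" for n
    using arg_cong[OF F, of "\<lambda>G. fps_nth G n"] by (simp add: fps_mult_nth atLeast0AtMost)
  note step = atMost_nat_numeral atMost_Suc fps_phase_slope_nth fps_phase_slope_nth(2)[simplified]
    fps_phase_offset_nth fps_phase_offset_nth(2)[simplified]
  show f0: "fps_nth F 0 = 1/2"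
    using conv[of 1] by (simp add: step field_simps)
  show f1: "fps_nth F 1 = 0"
    using conv[of 2] by (simp add: step field_simps)
  show f2: "fps_nth F 2 = 0"
    using conv[of 3] f0 f1 by (simp add: step field_simps)
  show f3: "fps_nth F 3 = 0"
    using conv[of 4] f0 f1 f2 by (simp add: step field_simps)
  show f4: "fps_nth F 4 = 1/720"
    using conv[of 5] f0 f1 f2 f3 by (simp add: step field_simps)
  show f5: "fps_nth F 5 = 0"
    using conv[of 6] f0 f1 f2 f3 f4 by (simp add: step field_simps)
  show f6: "fps_nth F 6 = 1/6720 - sqrt 3 / 8640"
    using conv[of 7] f0 f1 f2 f3 f4 f5 by (simp add: step field_simps)
qed

theorem mainTheorem1:
  shows
    \<comment> \<open>solving the zero phase-lag equation, on the whole range of the principal argument\<close>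
    "(\<forall>\<beta> :: real \<Rightarrow> real. \<forall>\<upsilon>\<in>{-pi<..pi}. \<upsilon> \<noteq> 0 \<longrightarrow> cos \<upsilon> \<noteq> 0 \<longrightarrow>
        M_fun \<upsilon> \<noteq> 0 \<and>
        (phase_lag (\<lambda>u. gauss2_with_b2 (\<beta> u)) \<upsilon> = 0 \<longleftrightarrow>
           \<beta> \<upsilon> = 1/2 * (N_fun \<upsilon> / M_fun \<upsilon>)))
     \<and> \<comment> \<open>for arbitrary real arguments, up to the branch of the argument modulo pi\<close>
     (\<forall>\<beta> :: real \<Rightarrow> real. \<forall>\<upsilon>. cos \<upsilon> \<noteq> 0 \<longrightarrow> M_fun \<upsilon> \<noteq> 0 \<longrightarrow>
        ((\<exists>k::int. phase_lag (\<lambda>u. gauss2_with_b2 (\<beta> u)) \<upsilon> = of_int k * pi) \<longleftrightarrow>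
           \<beta> \<upsilon> = 1/2 * (N_fun \<upsilon> / M_fun \<upsilon>)))
     \<and> \<comment> \<open>the resulting method has zero phase-lag\<close>
     (\<forall>\<upsilon>\<in>{-pi<..pi}. cos \<upsilon> \<noteq> 0 \<longrightarrow> phase_lag (\<lambda>u. gauss2_with_b2 (b2_opt u)) \<upsilon> = 0)
     \<and> \<comment> \<open>Taylor expansion at 0, where the singularity of the quotient is removable\<close>
     (\<exists>F :: real fps.
        (\<lambda>\<upsilon>. if \<upsilon> = 0 then 1/2 else b2_opt \<upsilon>) has_fps_expansion F \<and>
        fps_nth F 0 = 1/2 \<and> fps_nth F 1 = 0 \<and> fps_nth F 2 = 0 \<and> fps_nth F 3 = 0 \<and>
        fps_nth F 4 = 1/720 \<and> fps_nth F 5 = 0 \<and>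
        fps_nth F 6 = 1/6720 - sqrt 3 / 8640)
     \<and> \<comment> \<open>the Gauss coefficient is recovered in the limit\<close>
     (b2_opt \<longlongrightarrow> 1/2) (at 0) \<and> coeff_b gauss2 $ 2 = 1/2"
proof (intro conjI)
  show solve: "\<forall>\<beta> :: real \<Rightarrow> real. \<forall>\<upsilon>\<in>{-pi<..pi}. \<upsilon> \<noteq> 0 \<longrightarrow> cos \<upsilon> \<noteq> 0 \<longrightarrow>
      M_fun \<upsilon> \<noteq> 0 \<and>
      (phase_lag (\<lambda>u. gauss2_with_b2 (\<beta> u)) \<upsilon> = 0 \<longleftrightarrow>
         \<beta> \<upsilon> = 1/2 * (N_fun \<upsilon> / M_fun \<upsilon>))"
  proof (intro allI ballI impI conjI)
    fix \<beta> :: "real \<Rightarrow> real" and \<upsilon> :: real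
    assume \<upsilon>: "\<upsilon> \<in> {-pi<..pi}" "\<upsilon> \<noteq> 0" "cos \<upsilon> \<noteq> 0"
    show M: "M_fun \<upsilon> \<noteq> 0"
      by (rule M_fun_nonzero[OF \<upsilon>])
    show "phase_lag (\<lambda>u. gauss2_with_b2 (\<beta> u)) \<upsilon> = 0 \<longleftrightarrow> \<beta> \<upsilon> = 1/2 * (N_fun \<upsilon> / M_fun \<upsilon>)"
      unfolding phase_lag_eq_0_iff[OF \<upsilon>(1,2)] by (rule affine_root_iff[OF \<upsilon>(3) M])
  qed
  show "\<forall>\<beta> :: real \<Rightarrow> real. \<forall>\<upsilon>. cos \<upsilon> \<noteq> 0 \<longrightarrow> M_fun \<upsilon> \<noteq> 0 \<longrightarrow>
      ((\<exists>k::int. phase_lag (\<lambda>u. gauss2_with_b2 (\<beta> u)) \<upsilon> = of_int k * pi) \<longleftrightarrow>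
         \<beta> \<upsilon> = 1/2 * (N_fun \<upsilon> / M_fun \<upsilon>))"
  proof (intro allI impI)
    fix \<beta> :: "real \<Rightarrow> real" and \<upsilon> :: real
    assume "cos \<upsilon> \<noteq> 0" "M_fun \<upsilon> \<noteq> 0"
    then show "(\<exists>k::int. phase_lag (\<lambda>u. gauss2_with_b2 (\<beta> u)) \<upsilon> = of_int k * pi) \<longleftrightarrow>
        \<beta> \<upsilon> = 1/2 * (N_fun \<upsilon> / M_fun \<upsilon>)"
      unfolding sin_zero_iff_int2[symmetric] sin_phase_lag_eq_0_iff by (rule affine_root_iff)
  qed
  show "\<forall>\<upsilon>\<in>{-pi<..pi}. cos \<upsilon> \<noteq> 0 \<longrightarrow> phase_lag (\<lambda>u. gauss2_with_b2 (b2_opt u)) \<upsilon> = 0"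
  proof (intro ballI impI)
    fix \<upsilon> :: real
    assume "\<upsilon> \<in> {-pi<..pi}" "cos \<upsilon> \<noteq> 0"
    then show "phase_lag (\<lambda>u. gauss2_with_b2 (b2_opt u)) \<upsilon> = 0"
      using spec[OF solve, of b2_opt] b2_opt_def[of \<upsilon>]
      by (cases "\<upsilon> = 0") (simp_all add: phase_lag_at_0)
  qed
  obtain F where F: "(\<lambda>\<upsilon>. if \<upsilon> = 0 then 1/2 else b2_opt \<upsilon>) has_fps_expansion F"
      and eq: "F * fps_phase_slope = - fps_phase_offset"
    by (rule b2_opt_expansion)
  show "\<exists>F :: real fps. (\<lambda>\<upsilon>. if \<upsilon> = 0 then 1/2 else b2_opt \<upsilon>) has_fps_expansion F \<and>
      fps_nth F 0 = 1/2 \<and> fps_nth F 1 = 0 \<and> fps_nth F 2 = 0 \<and> fps_nth F 3 = 0 \<and>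
      fps_nth F 4 = 1/720 \<and> fps_nth F 5 = 0 \<and> fps_nth F 6 = 1/6720 - sqrt 3 / 8640"
    by (intro exI[of _ F] conjI F b2_opt_taylor_coefficients[OF eq])
  have "((\<lambda>\<upsilon>. if \<upsilon> = 0 then 1/2 else b2_opt \<upsilon>) \<longlongrightarrow> 1/2) (at 0)"
    using has_fps_expansion_imp_continuous[OF F, of UNIV] by (simp add: continuous_within)
  then show "(b2_opt \<longlongrightarrow> 1/2) (at 0)"
    by (rule Lim_transform_eventually) (simp add: eventually_at_filter)
  show "coeff_b gauss2 $ 2 = 1/2"
    by (simp add: gauss2_def)
qed

end
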